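(* Let $H,T,N,d_h,r$ be positive integers with $r\le d_h$. Let $A_1,\dots,A_H\in\mathbb{R}^{T\times N}$ be retrieval-weight matrices with $A_h=A$ for all $h\in[H]$, let $Y_1,\dots,Y_H\in\mathbb{R}^{T\times d_h}$ be target matrices, and let $\Pi_A\in\mathbb{R}^{T\times T}$ be the orthogonal projection onto the column space of $A$. Assume that there exists an optimal head-specific solution $\{V_h^\star\}_{h=1}^{H}$ (a minimizer of $\frac12\sum_{h=1}^H\|AV_h-Y_h\|^2$ over all $V_1,\dots,V_H\in\mathbb{R}^{N\times d_h}$) that admits a shared latent factorization $V_h^\star=\bar V W_h$ for all $h\in[H]$, where $\bar V\in\mathbb{R}^{N\times r}$ and $W_h\in\mathbb{R}^{r\times d_h}$. If $\Pi_A Y_h\neq \Pi_A Y_{h'}$ for some $h\neq h'$, then the correction $\widehat F=[\widehat F_1\mid\cdots\mid\widehat F_H]$ with $\widehat F_h=A\bar V W_h$ satisfies \[ \mathcal{L}(\widehat F)=\mathcal{L}_{\mathrm{Ind}}^\star<\mathcal{L}_{\mathrm{Share}}^\star . \]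
   Context: Notation: $[H]=\{1,\dots,H\}$, and $\|\cdot\|$ is the Frobenius norm for matrices. Retrieval-weight matrices: a retrieval-weight matrix is a matrix $A_h=[\alpha_{h,1},\dots,\alpha_{h,T}]^\top\in\mathbb{R}^{T\times N}$ whose rows $\alpha_{h,t}$ lie in the probability simplex $\Delta^{N-1}$ (nonnegative entries summing to one) and are sparse, i.e. each row is supported on at most $k$ indices for a fixed integer $1\le k\le N$. These matrices are fixed throughout. Loss: for a head-partitioned correction $F=[F_1\mid\cdots\mid F_H]$ with $F_h\in\mathbb{R}^{T\times d_h}$, define $$\mathcal{L}(F)=\frac12\sum_{h=1}^{H}\|F_h-Y_h\|^2 .$$ Two families are compared under the same fixed matrices $A_1,\dots,A_H$: - shared-realized-value family: $F_h=A_hV_{\mathrm{sh}}$ for all $h$, with a single matrix $V_{\mathrm{sh}}\in\mathbb{R}^{N\times d_h}$, and $\mathcal{L}_{\mathrm{Share}}^\star=\inf_{V_{\mathrm{sh}}}\mathcal{L}(F)$; - head-specific family: $F_h=A_hV_h$ with independent $V_1,\dots,V_H\in\mathbb{R}^{N\times d_h}$, and $\mathcal{L}_{\mathrm{Ind}}^\star=\inf_{\{V_h\}_{h=1}^H}\mathcal{L}(F)$. *)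

theory Defs
  imports "HOL-Analysis.Analysis"
begin

text \<open>
  Dimensions are index types: \<open>'t\<close> has \<open>T\<close> elements, \<open>'n\<close> has \<open>N\<close>, \<open>'d\<close> has \<open>d\<^sub>h\<close>,
  \<open>'r\<close> has \<open>r\<close>, and the heads \<open>[H]\<close> are the elements of \<open>'h\<close>. A head-partitioned
  matrix \<open>[F\<^sub>1 | \<dots> | F\<^sub>H]\<close> is the family of its blocks, a function on \<open>'h\<close>.
\<close>

definition prob_simplex :: "(real ^ 'n) set" where
  "prob_simplex = {a. (\<forall>i. 0 \<le> a $ i) \<and> (\<Sum>i\<in>UNIV. a $ i) = 1}"

definition retrieval_weight :: "nat \<Rightarrow> real ^ 'n ^ 't \<Rightarrow> bool" where
  "retrieval_weight k A \<longleftrightarrow>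
     (\<forall>t. row t A \<in> prob_simplex \<and> card {i. row t A $ i \<noteq> 0} \<le> k)"

text \<open>The library norm on \<open>real ^ 'd ^ 't\<close> is the Frobenius norm.\<close>

lemma norm_eq_frobenius:
  fixes M :: "real ^ 'd ^ 't"
  shows "norm M = sqrt (\<Sum>t\<in>UNIV. \<Sum>j\<in>UNIV. (M $ t $ j)\<^sup>2)"
  by (simp add: norm_vec_def L2_set_def sum_nonneg)

definition loss :: "('h::finite \<Rightarrow> real ^ 'd ^ 't) \<Rightarrow> ('h \<Rightarrow> real ^ 'd ^ 't) \<Rightarrow> real" where
  "loss Y F = 1 / 2 * (\<Sum>h\<in>UNIV. (norm (F h - Y h))\<^sup>2)"

definition loss_share ::
  "('h::finite \<Rightarrow> real ^ 'n ^ 't) \<Rightarrow> ('h \<Rightarrow> real ^ 'd ^ 't) \<Rightarrow> real" where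
  "loss_share A Y = (INF V :: real ^ 'd ^ 'n. loss Y (\<lambda>h. A h ** V))"

definition loss_ind ::
  "('h::finite \<Rightarrow> real ^ 'n ^ 't) \<Rightarrow> ('h \<Rightarrow> real ^ 'd ^ 't) \<Rightarrow> real" where
  "loss_ind A Y = (INF V :: 'h \<Rightarrow> real ^ 'd ^ 'n. loss Y (\<lambda>h. A h ** V h))"

definition is_orth_proj :: "real ^ 't ^ 't \<Rightarrow> (real ^ 't) set \<Rightarrow> bool" where
  "is_orth_proj P S \<longleftrightarrow> (\<forall>x. P *v x \<in> S \<and> (\<forall>y\<in>S. orthogonal (x - P *v x) y))"

definition col_proj :: "real ^ 'n ^ 't \<Rightarrow> real ^ 't ^ 't" where
  "col_proj A = (THE P. is_orth_proj P (span (columns A)))"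

lemma orth_proj_point_unique:
  fixes S :: "(real ^ 't) set"
  assumes S: "subspace S" and "u \<in> S" "v \<in> S"
    and u: "\<And>y. y \<in> S \<Longrightarrow> orthogonal (x - u) y"
    and v: "\<And>y. y \<in> S \<Longrightarrow> orthogonal (x - v) y"
  shows "u = v"
proof -
  have d: "u - v \<in> S"
    using assms by (simp add: subspace_diff)
  have "(u - v) \<bullet> (u - v) = (x - v) \<bullet> (u - v) - (x - u) \<bullet> (u - v)"
    by (simp add: algebra_simps)
  also have "\<dots> = 0"
    using u[OF d] v[OF d] by (simp add: orthogonal_def)
  finally show ?thesis by simp
qed

lemma ex1_orth_proj:
  fixes S :: "(real ^ 't) set"
  assumes S: "subspace S"
  shows "\<exists>!P. is_orth_proj P S"
proof -
  have "\<exists>u. u \<in> S \<and> (\<forall>y\<in>S. orthogonal (x - u) y)" for x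
  proof -
    obtain y z where "y \<in> span S" "\<And>w. w \<in> span S \<Longrightarrow> orthogonal z w" "x = y + z"
      using orthogonal_subspace_decomp_exists[of S x] by blast
    then show ?thesis
      using S by (intro exI[of _ y]) (auto simp: span_eq_iff[THEN iffD2, OF S])
  qed
  then obtain f where f: "\<And>x. f x \<in> S" "\<And>x y. y \<in> S \<Longrightarrow> orthogonal (x - f x) y"
    by metis
  have "linear f"
  proof (rule linearI)
    fix a b
    show "f (a + b) = f a + f b"
    proof (rule orth_proj_point_unique[OF S, of _ _ "a + b"])
      show "f a + f b \<in> S" using S f(1) by (simp add: subspace_add)
      show "orthogonal (a + b - (f a + f b)) y" if "y \<in> S" for y
        using f(2)[OF that, of a] f(2)[OF that, of b]
        by (simp add: orthogonal_def algebra_simps)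
    qed (use f in auto)
  next
    fix c a
    show "f (c *\<^sub>R a) = c *\<^sub>R f a"
    proof (rule orth_proj_point_unique[OF S, of _ _ "c *\<^sub>R a"])
      show "c *\<^sub>R f a \<in> S" using S f(1) by (simp add: subspace_scale)
      show "orthogonal (c *\<^sub>R a - c *\<^sub>R f a) y" if "y \<in> S" for y
        using f(2)[OF that, of a]
        by (simp add: orthogonal_def algebra_simps)
    qed (use f in auto)
  qed
  then have "matrix f *v x = f x" for x
    using matrix_works[of f x] by (simp add: linear_matrix_vector_mul_eq)
  with f have ex: "is_orth_proj (matrix f) S"
    by (simp add: is_orth_proj_def)
  show ?thesis
  proof (rule ex1I[of "\<lambda>P. is_orth_proj P S", OF ex])
    fix P assume P: "is_orth_proj P S"
    have "P *v x = matrix f *v x" for x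
      using P ex orth_proj_point_unique[OF S, of "P *v x" "matrix f *v x" x]
      by (auto simp: is_orth_proj_def)
    then show "P = matrix f"
      by (simp add: matrix_eq)
  qed
qed

lemma is_orth_proj_col_proj: "is_orth_proj (col_proj A) (span (columns A))"
  unfolding col_proj_def by (rule theI'[OF ex1_orth_proj[OF subspace_span]])

end

theory Submission
  imports Defs
begin

text \<open>
  With \<open>P = \<Pi>\<^sub>A\<close>, Pythagoras splits the loss of \<open>F\<^sub>h = A V\<^sub>h\<close> into a constant part
  \<open>1/2 \<Sum>\<^sub>h \<parallel>P Y\<^sub>h - Y\<^sub>h\<parallel>\<^sup>2\<close> and the part \<open>1/2 \<Sum>\<^sub>h \<parallel>A V\<^sub>h - P Y\<^sub>h\<parallel>\<^sup>2\<close>. Independent heads make the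
  second part vanish, whereas a single \<open>M = A V\<close> has to approximate two distinct matrices
  \<open>P Y\<^sub>h\<close> and \<open>P Y\<^sub>h\<^sub>'\<close> at once. By the parallelogram law this costs at least
  \<open>1/4 \<parallel>P Y\<^sub>h - P Y\<^sub>h\<^sub>'\<parallel>\<^sup>2\<close>, a bound independent of \<open>V\<close>, so the gap survives the infimum.
\<close>

lemma inner_matrix_columns:
  fixes M N :: "real ^ 'd ^ 't"
  shows "M \<bullet> N = (\<Sum>j\<in>UNIV. column j M \<bullet> column j N)"
  unfolding inner_vec_def column_def by simp (rule sum.swap)

lemma column_matrix_matrix_mult:
  fixes A :: "real ^ 'n ^ 't" and B :: "real ^ 'd ^ 'n"
  shows "column j (A ** B) = A *v column j B"
  by (simp add: vec_eq_iff column_def matrix_matrix_mult_def matrix_vector_mult_def)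

text \<open>Turns membership in the column space into an explicit preimage under
  \<open>A\<close>.\<close>

lemma span_columns_eq_range:
  fixes A :: "real ^ 'n ^ 't"
  shows "span (columns A) = range ((*v) A)"
proof
  have "subspace (range ((*v) A))"
    by (simp add: linear_subspace_image subspace_UNIV)
  moreover have "columns A \<subseteq> range ((*v) A)"
    by (auto simp: columns_image_basis)
  ultimately show "span (columns A) \<subseteq> range ((*v) A)"
    by (rule span_minimal[rotated])
  show "range ((*v) A) \<subseteq> span (columns A)"
    by (auto intro: matrix_vector_mult_in_columnspace)
qed

text \<open>Every column of the projected matrix lies in the range of \<open>A\<close>; preimages
  chosen column by column assemble into \<open>X\<close>.\<close>

lemma col_proj_mult_factors:
  fixes A :: "real ^ 'n ^ 't" and Y :: "real ^ 'd ^ 't"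
  shows "\<exists>X. A ** X = col_proj A ** Y"
proof -
  have "\<exists>x. A *v x = col_proj A *v column j Y" for j
    using is_orth_proj_col_proj[of A] unfolding is_orth_proj_def span_columns_eq_range
    by (metis (no_types) imageE)
  then obtain x where x: "\<And>j. A *v x j = col_proj A *v column j Y"
    by metis
  have "column j (\<chi> i j. x j $ i) = x j" for j
    by (simp add: column_def vec_eq_iff)
  then have "column j (A ** (\<chi> i j. x j $ i)) = column j (col_proj A ** Y)" for j
    by (simp add: column_matrix_matrix_mult x)
  then have "A ** (\<chi> i j. x j $ i) = col_proj A ** Y"
    by (simp add: column_def vec_eq_iff)
  then show ?thesis ..
qed

text \<open>The Frobenius inner product is a sum over columns, and each residual column is
  orthogonal to the range of \<open>A\<close>.\<close>

lemma inner_col_proj_residual: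
  fixes A :: "real ^ 'n ^ 't" and Y :: "real ^ 'd ^ 't"
  shows "(Y - col_proj A ** Y) \<bullet> (A ** Z) = 0"
proof -
  have "column j (Y - col_proj A ** Y) \<bullet> column j (A ** Z) = 0" for j
  proof -
    have "column j (Y - col_proj A ** Y) = column j Y - col_proj A *v column j Y"
      unfolding column_matrix_matrix_mult[symmetric] by (simp add: vec_eq_iff column_def)
    then show ?thesis
      using is_orth_proj_col_proj[of A]
      by (simp add: is_orth_proj_def span_columns_eq_range orthogonal_def
          column_matrix_matrix_mult)
  qed
  then show ?thesis
    by (simp add: inner_matrix_columns)
qed

lemma norm_residual_split:
  fixes A :: "real ^ 'n ^ 't" and Y :: "real ^ 'd ^ 't"
  shows "(norm (A ** V - Y))\<^sup>2
    = (norm (A ** V - col_proj A ** Y))\<^sup>2 + (norm (col_proj A ** Y - Y))\<^sup>2"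
proof -
  obtain X where X: "A ** X = col_proj A ** Y"
    using col_proj_mult_factors by blast
  \<comment> \<open>Both terms of the left factor have the form \<open>A ** Z\<close>, with
    \<open>Z = V\<close> and \<open>Z = X\<close>, so the residual is orthogonal to each.\<close>
  have "(A ** V - col_proj A ** Y) \<bullet> (col_proj A ** Y - Y) = 0"
    using inner_col_proj_residual[of Y A V] inner_col_proj_residual[of Y A X]
    unfolding X by (simp only: inner_diff_left inner_diff_right inner_commute)
  then have "(norm ((A ** V - col_proj A ** Y) + (col_proj A ** Y - Y)))\<^sup>2
      = (norm (A ** V - col_proj A ** Y))\<^sup>2 + (norm (col_proj A ** Y - Y))\<^sup>2"
    by (intro norm_add_Pythagorean) (simp add: orthogonal_def)
  then show ?thesis by simp
qed

lemma loss_split: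
  "loss Y (\<lambda>h. A ** V h)
    = loss (\<lambda>h. col_proj A ** Y h) (\<lambda>h. A ** V h) + loss Y (\<lambda>h. col_proj A ** Y h)"
  by (simp add: loss_def norm_residual_split[of A _ "Y _"] sum.distrib distrib_left)

lemma loss_nonneg: "0 \<le> loss Y F"
  by (simp add: loss_def sum_nonneg)

text \<open>Parallelogram law for \<open>m - a\<close> and \<open>m - b\<close>, whose difference is
  \<open>a - b\<close> up to sign; the square of their sum is dropped.\<close>

lemma norm_diff_squared_le:
  fixes a b m :: "'a::real_inner"
  shows "(norm (a - b))\<^sup>2 \<le> 2 * ((norm (m - a))\<^sup>2 + (norm (m - b))\<^sup>2)"
proof -
  have "2 * ((norm (m - a))\<^sup>2 + (norm (m - b))\<^sup>2)
      = (norm (a - b))\<^sup>2 + (norm ((m - a) + (m - b)))\<^sup>2"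
    by (simp add: power2_norm_eq_inner algebra_simps inner_commute)
  then show ?thesis by simp
qed

text \<open>Heads other than \<open>h\<close> and \<open>h'\<close> contribute nonnegative terms.
  The 1/4 combines the 1/2 in \<open>loss\<close> with the factor 2 of the parallelogram
  bound.\<close>

lemma loss_const_ge:
  assumes "h \<noteq> h'"
  shows "(norm (Y h - Y h'))\<^sup>2 / 4 \<le> loss Y (\<lambda>_. M)"
proof -
  have "(\<Sum>i\<in>{h, h'}. (norm (M - Y i))\<^sup>2) \<le> (\<Sum>i\<in>UNIV. (norm (M - Y i))\<^sup>2)"
    by (rule sum_mono2) auto
  then show ?thesis
    using norm_diff_squared_le[of "Y h" "Y h'" M] assms by (simp add: loss_def)
qed

lemma loss_ind_eq_min:
  assumes "is_arg_min (\<lambda>V. loss Y (\<lambda>h. A h ** V h)) (\<lambda>_. True) V"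
  shows "loss_ind A Y = loss Y (\<lambda>h. A h ** V h)"
  unfolding loss_ind_def
proof (rule cInf_eq_minimum)
  show "loss Y (\<lambda>h. A h ** V h) \<le> l" if "l \<in> range (\<lambda>V. loss Y (\<lambda>h. A h ** V h))" for l
    using that assms unfolding is_arg_min_linorder by blast
qed (rule rangeI)

text \<open>The value is attained by preimages of the projected targets, one per head, and
  \<open>loss_split\<close> bounds every other choice from below.\<close>

lemma loss_ind_const: "loss_ind (\<lambda>_. A) Y = loss Y (\<lambda>h. col_proj A ** Y h)"
  unfolding loss_ind_def
proof (rule cInf_eq_minimum)
  have "\<forall>h. \<exists>X. A ** X = col_proj A ** Y h"
    by (simp only: col_proj_mult_factors simp_thms)
  then obtain X where "\<forall>h. A ** X h = col_proj A ** Y h"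
    by (rule choice[THEN exE])
  then have "loss Y (\<lambda>h. col_proj A ** Y h) = loss Y (\<lambda>h. A ** X h)"
    by simp
  then show "loss Y (\<lambda>h. col_proj A ** Y h) \<in> range (\<lambda>V. loss Y (\<lambda>h. A ** V h))"
    by (rule image_eqI[where x = X]) (rule UNIV_I)
  show "loss Y (\<lambda>h. col_proj A ** Y h) \<le> l" if "l \<in> range (\<lambda>V. loss Y (\<lambda>h. A ** V h))" for l
  proof -
    obtain V where "l = loss Y (\<lambda>h. A ** V h)"
      using \<open>l \<in> _\<close> by (rule rangeE)
    then show ?thesis
      using loss_split[of Y A V] loss_nonneg[of "\<lambda>h. col_proj A ** Y h"] by simp
  qed
qed

lemma loss_share_const_ge:
  assumes "h \<noteq> h'"
  shows "loss_ind (\<lambda>_. A) Y + (norm (col_proj A ** Y h - col_proj A ** Y h'))\<^sup>2 / 4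
    \<le> loss_share (\<lambda>_. A) Y"
  unfolding loss_share_def loss_ind_const
proof (rule cINF_greatest)
  fix V
  show "loss Y (\<lambda>h. col_proj A ** Y h) + (norm (col_proj A ** Y h - col_proj A ** Y h'))\<^sup>2 / 4
    \<le> loss Y (\<lambda>h. A ** V)"
    using loss_const_ge[OF assms, of "\<lambda>h. col_proj A ** Y h" "A ** V"]
      loss_split[of Y A "\<lambda>_. V"] by linarith
qed simp

theorem theorem4p1:
  fixes Ah :: "'h::finite \<Rightarrow> real ^ 'n ^ 't"
    and A :: "real ^ 'n ^ 't"
    and Y :: "'h \<Rightarrow> real ^ 'd ^ 't"
    and Vstar :: "'h \<Rightarrow> real ^ 'd ^ 'n"
    and Vbar :: "real ^ 'r ^ 'n"
    and W :: "'h \<Rightarrow> real ^ 'd ^ 'r"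
    and k :: nat
  assumes "CARD('r) \<le> CARD('d)"
    and "1 \<le> k" and "k \<le> CARD('n)"
    and "\<And>h. retrieval_weight k (Ah h)"
    and "\<And>h. Ah h = A"
    and "is_arg_min (\<lambda>V :: 'h \<Rightarrow> real ^ 'd ^ 'n. loss Y (\<lambda>h. A ** V h)) (\<lambda>_. True) Vstar"
    and "\<And>h. Vstar h = Vbar ** W h"
    and "\<exists>h h'. h \<noteq> h' \<and> col_proj A ** Y h \<noteq> col_proj A ** Y h'"
  shows "loss Y (\<lambda>h. A ** Vbar ** W h) = loss_ind Ah Y \<and> loss_ind Ah Y < loss_share Ah Y"
proof
  have Ah: "Ah = (\<lambda>_. A)"
    using assms(5) by auto
  \<comment> \<open>By associativity the factored correction is \<open>A ** Vstar h\<close>, the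
    correction of the given minimizer.\<close>
  show "loss Y (\<lambda>h. A ** Vbar ** W h) = loss_ind Ah Y"
    using loss_ind_eq_min[OF assms(6)] by (simp add: Ah assms(7) matrix_mul_assoc)
  obtain h h' where h: "h \<noteq> h'" and ne: "col_proj A ** Y h \<noteq> col_proj A ** Y h'"
    using assms(8) by blast
  have "0 < (norm (col_proj A ** Y h - col_proj A ** Y h'))\<^sup>2 / 4"
    using ne by simp
  then show "loss_ind Ah Y < loss_share Ah Y"
    using loss_share_const_ge[OF h, of A Y] unfolding Ah by linarith
qed

end
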